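(* Let $\mathcal{A}(\lambda)=A_0+\sum_{i=1}^m\lambda_iA_i$ with $A_i\in\mathbb{C}^{k\times\ell}$, $k=\ell+m-1$, define a rectangular multiparameter eigenvalue problem $\mathcal{A}(\lambda)x=0$, let $E_0,\dots,E_m\in\mathbb{C}^{k\times\ell}$ be given error matrices, and let $(\tilde\lambda,\tilde x)\in\mathbb{C}^m\times\mathbb{C}^\ell$ with $\tilde x\neq 0$ be an approximate eigenpair. Then the norm-wise backward error of the eigenpair is $$\eta(\tilde\lambda,\tilde x)=\frac{\|\tilde r\|_2}{\tilde\gamma\,\|\tilde x\|_2},$$ where $\tilde r=\mathcal{A}(\tilde\lambda)\tilde x$ is the residual and $\tilde\gamma=\|E_0\|_2+\sum_{i=1}^m|\tilde\lambda_i|\,\|E_i\|_2$.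
   Context: $\|\cdot\|_2$ denotes the Euclidean norm of vectors and the induced (spectral) norm of matrices. Rectangular multiparameter eigenvalue problem (rMEP): the coefficient matrices $A_0,\dots,A_m\in\mathbb{C}^{k\times\ell}$, $k=\ell+m-1$, are such that $\mathcal{A}(\lambda)=A_0+\sum_{i=1}^m\lambda_iA_i$ has full normal rank (rank $\ell$ at a generic $\lambda\in\mathbb{C}^m$); one seeks $\lambda=(\lambda_1,\dots,\lambda_m)\in\mathbb{C}^m$ and $x\in\mathbb{C}^\ell\setminus\{0\}$ with $\mathcal{A}(\lambda)x=0$. The error matrices $E_i$ fix the scaling of perturbations (e.g. $E_i=A_i$ for relative perturbations, or $E_i$ equal to the all-ones matrix divided by $\sqrt{k\ell}$ for absolute ones). The norm-wise backward error of $(\tilde\lambda,\tilde x)$ is $$\eta(\tilde\lambda,\tilde x)=\min\Big\{\epsilon\ge 0:\ \exists\,\Delta A_0,\dots,\Delta A_m\in\mathbb{C}^{k\times\ell},\ \Big(A_0+\Delta A_0+\sum_{i=1}^m\tilde\lambda_i(A_i+\Delta A_i)\Big)\tilde x=0,\ \|\Delta A_i\|_2\le\epsilon\|E_i\|_2,\ i=0,\dots,m\Big\}.$$ Convention: if $\tilde r=0$ the right-hand quotient is read as $0$ (even if $\tilde\gamma=0$); if $\tilde r\neq0$ and $\tilde\gamma=0$, both sides are $+\infty$. *)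

theory Defs
  imports "HOL-Analysis.Analysis"
begin

text \<open>
  The index types 'k, 'l, 'm carry the dimensions $k$, $l$, $m$. The coefficient matrix
  $A_0$ is a separate argument and $A_1, \dots, A_m$ form a family indexed by 'm; the
  same split is used for the $E_i$ and $\Delta A_i$.
\<close>

definition mpencil ::
  "complex^'l^'k \<Rightarrow> ('m::finite \<Rightarrow> complex^'l^'k) \<Rightarrow> complex^'m \<Rightarrow> complex^'l^'k" where
  "mpencil A0 A lam = A0 + (\<Sum>i\<in>UNIV. map_matrix ((*) (lam $ i)) (A i))"

text \<open>
  Normal rank: the rank at a generic point, which is the largest rank attained. The library
  function \<^const>\<open>rank\<close> is used here over the complex field.
\<close>

definition normal_rank ::
  "complex^'l^'k \<Rightarrow> ('m::finite \<Rightarrow> complex^'l^'k) \<Rightarrow> nat" where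
  "normal_rank A0 A = Max (range (\<lambda>lam. rank (mpencil A0 A lam)))"

text \<open>
  The library norm on \<^typ>\<open>complex^'n\<close> is the Euclidean one, but on
  \<^typ>\<open>complex^'l^'k\<close> it is the Frobenius norm; hence the operator norm here.
\<close>

definition spectral_norm :: "complex^'l^'k \<Rightarrow> real" where
  "spectral_norm M = onorm ((*v) M)"

definition residual ::
  "complex^'l^'k \<Rightarrow> ('m::finite \<Rightarrow> complex^'l^'k) \<Rightarrow> complex^'m \<Rightarrow> complex^'l \<Rightarrow> complex^'k" where
  "residual A0 A lam x = mpencil A0 A lam *v x"

definition error_weight ::
  "complex^'l^'k \<Rightarrow> ('m::finite \<Rightarrow> complex^'l^'k) \<Rightarrow> complex^'m \<Rightarrow> real" where
  "error_weight E0 E lam =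
     spectral_norm E0 + (\<Sum>i\<in>UNIV. cmod (lam $ i) * spectral_norm (E i))"

definition admissible_eps ::
  "complex^'l^'k \<Rightarrow> ('m::finite \<Rightarrow> complex^'l^'k) \<Rightarrow> complex^'l^'k \<Rightarrow> ('m \<Rightarrow> complex^'l^'k)
     \<Rightarrow> complex^'m \<Rightarrow> complex^'l \<Rightarrow> real set" where
  "admissible_eps A0 A E0 E lam x =
     {eps. 0 \<le> eps \<and>
       (\<exists>D0 D. mpencil (A0 + D0) (\<lambda>i. A i + D i) lam *v x = 0 \<and>
         spectral_norm D0 \<le> eps * spectral_norm E0 \<and>
         (\<forall>i. spectral_norm (D i) \<le> eps * spectral_norm (E i)))}"

text \<open>
  Extended-real valued: the infimum over the empty set is \<open>\<infinity>\<close>. That a nonempty set of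
  admissible values has a minimum is not built in and has to be claimed separately.
\<close>

definition backward_error ::
  "complex^'l^'k \<Rightarrow> ('m::finite \<Rightarrow> complex^'l^'k) \<Rightarrow> complex^'l^'k \<Rightarrow> ('m \<Rightarrow> complex^'l^'k)
     \<Rightarrow> complex^'m \<Rightarrow> complex^'l \<Rightarrow> ereal" where
  "backward_error A0 A E0 E lam x = (INF eps\<in>admissible_eps A0 A E0 E lam x. ereal eps)"

text \<open>
  Division on \<^typ>\<open>ereal\<close> realises the convention for a zero denominator:
  $0/0 = 0$ and $a/0 = \infty$ for $a > 0$.
\<close>

lemma ereal_quotient_by_zero:
  fixes a :: real
  assumes "0 \<le> a"
  shows "ereal a / 0 = (if a = 0 then 0 else \<infinity>)"
  using assms by (auto simp: divide_ereal_def)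

end

theory Submission
  imports Defs
begin

text \<open>
  Write \<open>r\<close> for the residual and \<open>\<gamma>\<close> for the error weight. Everything follows from an exact
  description of the admissible values (\<open>admissible_eps_iff\<close>): a number \<open>eps \<ge> 0\<close> is admissible
  if and only if \<open>\<parallel>r\<parallel> \<le> eps * \<gamma> * \<parallel>x\<parallel>\<close>.

  Since the pencil is linear in its coefficients, perturbations \<open>D0, D\<close> make \<open>x\<close> an exact
  eigenvector precisely when their own pencil, evaluated at \<open>lam\<close>, sends \<open>x\<close> to \<open>-r\<close>. The triangle
  inequality bounds the norm of that image by \<open>eps * \<gamma> * \<parallel>x\<parallel>\<close> (\<open>norm_residual_le\<close>), which gives
  necessity. For sufficiency a single matrix of rank one, \<open>r x\<^sup>*\<close>, is distributed over the
  coefficients: each one gets a share proportional to its \<open>\<parallel>E\<^sub>i\<parallel>\<close>, multiplied by a unimodular number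
  that cancels the phase of \<open>lam\<^sub>i\<close>. All terms of the perturbing pencil are then aligned, so
  the triangle inequality is an equality and the necessary bound is attained.

  The admissible values thus form a closed half-line starting at \<open>\<parallel>r\<parallel> / (\<gamma> * \<parallel>x\<parallel>)\<close>. It is empty
  exactly when \<open>\<gamma> = 0\<close> and \<open>r \<noteq> 0\<close>, where both sides of the formula are infinite.
\<close>

section \<open>Pencils acting on vectors\<close>

lemma norm_vector_scalar_mult:
  fixes v :: "complex^'n"
  shows "norm (c *s v) = cmod c * norm v"
  by (simp add: norm_vec_def norm_mult L2_set_right_distrib)

lemma map_matrix_scalar_mult_vector:
  fixes M :: "complex^'l^'k"
  shows "map_matrix ((*) c) M *v y = c *s (M *v y)"
  by (simp add: vec_eq_iff map_matrix_def matrix_vector_mult_def sum_distrib_left mult.assoc)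

lemma sum_matrix_vector_mult:
  fixes M :: "'m \<Rightarrow> complex^'l^'k"
  assumes "finite I"
  shows "(\<Sum>i\<in>I. M i) *v y = (\<Sum>i\<in>I. M i *v y)"
  using assms by (induction I) (simp_all add: matrix_vector_mult_add_rdistrib)

lemma residual_eq_sum:
  "residual A0 A lam y = A0 *v y + (\<Sum>i\<in>UNIV. lam $ i *s (A i *v y))"
  by (simp add: residual_def mpencil_def matrix_vector_mult_add_rdistrib
      sum_matrix_vector_mult map_matrix_scalar_mult_vector)

lemma residual_add:
  "residual (A0 + D0) (\<lambda>i. A i + D i) lam y = residual A0 A lam y + residual D0 D lam y"
  by (simp add: residual_eq_sum matrix_vector_mult_add_rdistrib vector_add_ldistrib sum.distrib)

section \<open>The spectral norm\<close>

text \<open>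
  Complex spaces are regarded as real normed spaces of finite dimension, where every linear
  map is bounded. This makes the supremum in the operator norm a genuine bound.
\<close>

lemma bounded_linear_complex_matrix_vector_mult:
  fixes M :: "complex^'l^'k"
  shows "bounded_linear ((*v) M)"
proof -
  have "linear ((*v) M)"
    by (rule linearI)
      (simp_all add: vec_eq_iff matrix_vector_mult_def distrib_left sum.distrib scaleR_sum_right)
  then show ?thesis
    by (simp add: linear_conv_bounded_linear)
qed

lemma norm_matrix_vector_mult_le:
  "norm (M *v y) \<le> spectral_norm M * norm y"
  unfolding spectral_norm_def by (rule onorm[OF bounded_linear_complex_matrix_vector_mult])

lemma spectral_norm_nonneg: "0 \<le> spectral_norm M"
  unfolding spectral_norm_def by (rule onorm_pos_le[OF bounded_linear_complex_matrix_vector_mult])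

lemma spectral_norm_le:
  assumes "\<And>y. norm (M *v y) \<le> b * norm y"
  shows "spectral_norm M \<le> b"
  unfolding spectral_norm_def using assms by (rule onorm_le)

lemma error_weight_nonneg: "0 \<le> error_weight E0 E lam"
  by (simp add: error_weight_def spectral_norm_nonneg sum_nonneg)

lemma norm_residual_le:
  fixes D0 E0 :: "complex^'l^'k"
  assumes D0: "spectral_norm D0 \<le> eps * spectral_norm E0"
    and D: "\<And>i. spectral_norm (D i) \<le> eps * spectral_norm (E i)"
  shows "norm (residual D0 D lam y) \<le> eps * error_weight E0 E lam * norm y"
proof -
  have bound: "norm (M *v y) \<le> eps * spectral_norm N * norm y"
    if "spectral_norm M \<le> eps * spectral_norm N" for M N :: "complex^'l^'k"
    using norm_matrix_vector_mult_le[of M y] mult_right_mono[OF that, of "norm y"] by simp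
  have "norm (residual D0 D lam y)
      \<le> norm (D0 *v y) + (\<Sum>i\<in>UNIV. cmod (lam $ i) * norm (D i *v y))"
    unfolding residual_eq_sum
    by (rule order_trans[OF norm_triangle_ineq add_left_mono[OF sum_norm_le]])
      (simp add: norm_vector_scalar_mult)
  also have "\<dots> \<le> eps * spectral_norm E0 * norm y
      + (\<Sum>i\<in>UNIV. cmod (lam $ i) * (eps * spectral_norm (E i) * norm y))"
    by (intro add_mono sum_mono mult_left_mono bound D0 D) simp
  also have "\<dots> = eps * error_weight E0 E lam * norm y"
    by (simp add: error_weight_def algebra_simps sum_distrib_left sum_distrib_right)
  finally show ?thesis .
qed

section \<open>The optimal perturbation\<close>

text \<open>The rank-one matrix \<open>c u v\<^sup>*\<close>.\<close>

definition outer :: "complex \<Rightarrow> complex^'k \<Rightarrow> complex^'l \<Rightarrow> complex^'l^'k" where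
  "outer c u v = (\<chi> i j. c * u $ i * cnj (v $ j))"

lemma outer_mult_vector:
  "outer c u v *v y = (c * (\<Sum>j\<in>UNIV. cnj (v $ j) * y $ j)) *s u"
  by (simp add: vec_eq_iff outer_def matrix_vector_mult_def sum_distrib_left ac_simps)

lemma outer_mult_self: "outer c u v *v v = (c * of_real ((norm v)\<^sup>2)) *s u"
proof -
  have "(\<Sum>j\<in>UNIV. cnj (v $ j) * v $ j) = of_real ((norm v)\<^sup>2)"
    by (simp add: norm_vec_def L2_set_def sum_nonneg complex_norm_square[symmetric] mult.commute)
  then show ?thesis
    by (simp add: outer_mult_vector)
qed

text \<open>This is the Cauchy--Schwarz inequality for the Hermitian inner product.\<close>

lemma spectral_norm_outer_le: "spectral_norm (outer c u v) \<le> cmod c * norm u * norm v"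
proof (rule spectral_norm_le)
  fix y :: "complex^'a"
  have "cmod (\<Sum>j\<in>UNIV. cnj (v $ j) * y $ j) \<le> (\<Sum>j\<in>UNIV. \<bar>cmod (v $ j)\<bar> * \<bar>cmod (y $ j)\<bar>)"
    by (rule sum_norm_le) (simp add: norm_mult)
  also have "\<dots> \<le> norm v * norm y"
    unfolding norm_vec_def by (rule L2_set_mult_ineq)
  finally have "cmod c * cmod (\<Sum>j\<in>UNIV. cnj (v $ j) * y $ j) * norm u
      \<le> cmod c * (norm v * norm y) * norm u"
    by (intro mult_right_mono mult_left_mono) auto
  then show "norm (outer c u v *v y) \<le> cmod c * norm u * norm v * norm y"
    by (simp add: outer_mult_vector norm_vector_scalar_mult norm_mult ac_simps)
qed

text \<open>
  The constant \<open>\<parallel>E0\<parallel> / (\<gamma> \<parallel>x\<parallel>\<^sup>2)\<close>, and likewise for \<open>E i\<close>, is the share of each coefficient: the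
  shares, weighted by \<open>\<bar>lam\<^sub>i\<bar>\<close>, add up to \<open>1 / \<parallel>x\<parallel>\<^sup>2\<close>, which normalizes \<open>r x\<^sup>* x = \<parallel>x\<parallel>\<^sup>2 r\<close>.
\<close>

lemma exists_optimal_perturbation:
  fixes E0 :: "complex^'l^'k" and E :: "'m::finite \<Rightarrow> complex^'l^'k"
    and x :: "complex^'l" and r :: "complex^'k"
  assumes x: "x \<noteq> 0" and weight: "error_weight E0 E lam > 0"
  defines "q \<equiv> norm r / (error_weight E0 E lam * norm x)"
  obtains D0 D where
    "residual D0 D lam x = - r"
    "spectral_norm D0 \<le> q * spectral_norm E0"
    "\<And>i. spectral_norm (D i) \<le> q * spectral_norm (E i)"
proof -
  define g where "g = error_weight E0 E lam"
  define share where "share s = s / (g * (norm x)\<^sup>2)" for s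
  \<comment> \<open>At \<open>lam $ i = 0\<close> the phase is \<open>sgn 0 = 0\<close>; this is harmless, as \<open>D i\<close> enters the pencil with factor 0.\<close>
  define phase where "phase i = cnj (sgn (lam $ i))" for i
  define D0 where "D0 = outer (- of_real (share (spectral_norm E0))) r x"
  define D where "D i = outer (- (phase i * of_real (share (spectral_norm (E i))))) r x" for i
  have g: "g > 0" and nx: "norm x > 0"
    using weight x by (simp_all add: g_def)
  have norm_le: "spectral_norm (outer c r x) \<le> q * s" if "cmod c \<le> share s" "0 \<le> s" for c s
  proof -
    have "cmod c * norm r * norm x \<le> share s * norm r * norm x"
      using that by (intro mult_right_mono) auto
    also have "\<dots> = q * s"
      using g nx by (simp add: share_def q_def g_def[symmetric] field_simps power2_eq_square)
    finally show ?thesis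
      using spectral_norm_outer_le[of c r x] by linarith
  qed
  have share_nonneg: "0 \<le> share s" if "0 \<le> s" for s
    using that g by (simp add: share_def)
  have phase_le: "cmod (phase i) \<le> 1" for i
    by (simp add: phase_def norm_sgn)
  have phase_mult: "lam $ i * phase i = of_real (cmod (lam $ i))" for i
  proof (cases "lam $ i = 0")
    case False
    then have "lam $ i * cnj (lam $ i) = of_real (cmod (lam $ i)) * of_real (cmod (lam $ i))"
      by (simp add: complex_norm_square[symmetric] power2_eq_square[symmetric])
    then show ?thesis
      using False by (simp add: phase_def sgn_eq field_simps)
  qed (simp add: phase_def)
  have scaled_term: "lam $ i *s (D i *v x)
      = (- of_real (cmod (lam $ i) * spectral_norm (E i) / g)) *s r" for i
  proof -
    have "lam $ i *s (D i *v x)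
        = (- ((lam $ i * phase i) * of_real (share (spectral_norm (E i)) * (norm x)\<^sup>2))) *s r"
      by (simp add: D_def outer_mult_self vector_smult_assoc ac_simps)
    also have "\<dots> = (- of_real (cmod (lam $ i) * (share (spectral_norm (E i)) * (norm x)\<^sup>2))) *s r"
      by (simp add: phase_mult)
    also have "cmod (lam $ i) * (share (spectral_norm (E i)) * (norm x)\<^sup>2)
        = cmod (lam $ i) * spectral_norm (E i) / g"
      using nx by (simp add: share_def)
    finally show ?thesis .
  qed
  have "D0 *v x = (- of_real (share (spectral_norm E0) * (norm x)\<^sup>2)) *s r"
    by (simp add: D0_def outer_mult_self)
  also have "share (spectral_norm E0) * (norm x)\<^sup>2 = spectral_norm E0 / g"
    using nx by (simp add: share_def)
  finally have "residual D0 D lam x = (- of_real (spectral_norm E0 / g)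
      + (\<Sum>i\<in>UNIV. - of_real (cmod (lam $ i) * spectral_norm (E i) / g))) *s r"
    by (simp add: residual_eq_sum scaled_term vec_eq_iff algebra_simps sum_distrib_left
        sum_distrib_right sum_negf)
  also have "- of_real (spectral_norm E0 / g)
      + (\<Sum>i\<in>UNIV. - of_real (cmod (lam $ i) * spectral_norm (E i) / g))
      = (of_real (- (error_weight E0 E lam / g)) :: complex)"
    by (simp add: error_weight_def sum_negf add_divide_distrib sum_divide_distrib)
  also have "\<dots> *s r = - r"
    using g by (simp add: g_def vec_eq_iff)
  finally have "residual D0 D lam x = - r" .
  moreover have "spectral_norm D0 \<le> q * spectral_norm E0"
    unfolding D0_def by (rule norm_le) (simp_all add: share_nonneg spectral_norm_nonneg)
  moreover have "spectral_norm (D i) \<le> q * spectral_norm (E i)" for i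
    unfolding D_def
    by (rule norm_le)
      (simp_all add: norm_mult share_nonneg spectral_norm_nonneg phase_le mult_left_le_one_le)
  ultimately show thesis
    by (rule that)
qed

section \<open>The backward error\<close>

lemma admissible_eps_iff:
  fixes A0 E0 :: "complex^'l^'k" and A E :: "'m::finite \<Rightarrow> complex^'l^'k"
    and x :: "complex^'l"
  assumes x: "x \<noteq> 0"
  shows "eps \<in> admissible_eps A0 A E0 E lam x \<longleftrightarrow>
    0 \<le> eps \<and> norm (residual A0 A lam x) \<le> eps * error_weight E0 E lam * norm x"
    (is "_ \<longleftrightarrow> 0 \<le> eps \<and> norm ?r \<le> eps * ?g * norm x")
proof -
  have admissible: "eps \<in> admissible_eps A0 A E0 E lam x \<longleftrightarrow> 0 \<le> eps \<and>
      (\<exists>D0 D. residual D0 D lam x = - ?r \<and> spectral_norm D0 \<le> eps * spectral_norm E0 \<and>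
        (\<forall>i. spectral_norm (D i) \<le> eps * spectral_norm (E i)))"
    by (simp add: admissible_eps_def residual_def[symmetric] residual_add
        add_eq_0_iff)
  show ?thesis
  proof (intro iffI conjI; (elim conjE)?)
    assume "eps \<in> admissible_eps A0 A E0 E lam x"
    then obtain D0 D where "0 \<le> eps" and res: "residual D0 D lam x = - ?r"
      and "spectral_norm D0 \<le> eps * spectral_norm E0"
      and "\<And>i. spectral_norm (D i) \<le> eps * spectral_norm (E i)"
      unfolding admissible by blast
    then show "0 \<le> eps" "norm ?r \<le> eps * ?g * norm x"
      using norm_residual_le[of D0 eps E0 D E lam x] by simp_all
  next
    assume eps: "0 \<le> eps" and le: "norm ?r \<le> eps * ?g * norm x"
    have "\<exists>D0 D. residual D0 D lam x = - ?r \<and> spectral_norm D0 \<le> eps * spectral_norm E0 \<and>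
        (\<forall>i. spectral_norm (D i) \<le> eps * spectral_norm (E i))"
    proof (cases "?g = 0")
      case True
      \<comment> \<open>The residual vanishes, so that no perturbation is needed.\<close>
      with le have "?r = 0"
        by simp
      moreover have "spectral_norm (0 :: complex^'l^'k) \<le> 0"
        by (rule spectral_norm_le) simp
      then have "spectral_norm (0 :: complex^'l^'k) \<le> eps * spectral_norm N" for N :: "complex^'l^'k"
        using mult_nonneg_nonneg[OF eps spectral_norm_nonneg[of N]] by linarith
      ultimately show ?thesis
        by (intro exI[of _ 0] exI[of _ "\<lambda>_. 0"]) (simp add: residual_eq_sum)
    next
      case False
      then have g: "?g > 0"
        using error_weight_nonneg[of E0 E lam] by linarith
      obtain D0 D where "residual D0 D lam x = - ?r"
        and D0: "spectral_norm D0 \<le> norm ?r / (?g * norm x) * spectral_norm E0"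
        and D: "\<And>i. spectral_norm (D i) \<le> norm ?r / (?g * norm x) * spectral_norm (E i)"
        using exists_optimal_perturbation[OF x g, of ?r] by blast
      have "norm ?r / (?g * norm x) \<le> eps"
        using le g x by (simp add: divide_le_eq mult.assoc)
      then have "norm ?r / (?g * norm x) * spectral_norm N \<le> eps * spectral_norm N"
        for N :: "complex^'l^'k"
        by (rule mult_right_mono[OF _ spectral_norm_nonneg])
      with \<open>residual D0 D lam x = - ?r\<close> show ?thesis
        using D0 D order_trans by blast
    qed
    with eps show "eps \<in> admissible_eps A0 A E0 E lam x"
      unfolding admissible by blast
  qed
qed

theorem mainTheorem1:
  fixes A0 E0 :: "complex^'l^'k"
    and A E :: "'m::finite \<Rightarrow> complex^'l^'k"
    and lam :: "complex^'m"
    and x :: "complex^'l"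
  assumes dims: "CARD('k) = CARD('l) + CARD('m) - 1"
    and full_normal_rank: "normal_rank A0 A = CARD('l)"
    and nonzero: "x \<noteq> 0"
  shows "backward_error A0 A E0 E lam x =
           ereal (norm (residual A0 A lam x)) / ereal (error_weight E0 E lam * norm x) \<and>
         (admissible_eps A0 A E0 E lam x \<noteq> {} \<longrightarrow>
           (\<exists>eps\<in>admissible_eps A0 A E0 E lam x. backward_error A0 A E0 E lam x = ereal eps))"
proof -
  let ?S = "admissible_eps A0 A E0 E lam x"
  define r where "r = norm (residual A0 A lam x)"
  define d where "d = error_weight E0 E lam * norm x"
  have d: "0 \<le> d" and r: "0 \<le> r"
    by (simp_all add: d_def r_def error_weight_nonneg)
  have S: "eps \<in> ?S \<longleftrightarrow> 0 \<le> eps \<and> r \<le> eps * d" for eps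
    using admissible_eps_iff[OF nonzero] by (simp add: r_def d_def mult.assoc)
  show ?thesis
  proof (cases "d = 0 \<and> r \<noteq> 0")
    case True
    then have "?S = {}"
      using S r by auto
    moreover have "ereal r / ereal d = \<infinity>"
      using True r ereal_quotient_by_zero[of r] by (simp add: zero_ereal_def)
    ultimately show ?thesis
      by (simp add: backward_error_def r_def d_def top_ereal_def)
  next
    case False
    \<comment> \<open>If \<open>d = 0\<close> then \<open>r = 0\<close>, and real and extended division agree that \<open>0 / 0 = 0\<close>.\<close>
    have mem: "r / d \<in> ?S"
      using False d r by (auto simp: S)
    have lower: "r / d \<le> eps" if "eps \<in> ?S" for eps
      using that d by (cases "d = 0") (auto simp: S divide_le_eq)
    have "backward_error A0 A E0 E lam x = ereal (r / d)"
      unfolding backward_error_def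
      by (rule antisym[OF INF_lower[OF mem] INF_greatest]) (simp add: lower)
    moreover have "ereal r / ereal d = ereal (r / d)"
      using False d by (cases "d = 0") (auto simp: zero_ereal_def[symmetric])
    ultimately show ?thesis
      using mem by (auto simp: r_def d_def)
  qed
qed

end
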